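(* Let $q$ be a prime power and $a,b,d,d_1,d_2,u$ positive integers with $2d\le d_1+d_2$. Then $\Lambda(q,a,b,d,u)\ge\min\{A_q(a,d_1;u),A_q(b,d_2;u)\}$.
   Context: $\Lambda(q,a,b,d,u)$ is the maximum size of a set of $a\times b$ matrices over $\mathbb{F}_q$ such that any two distinct elements $X,Y$ satisfy $\mathrm{rk}(X-Y)\ge d$ and every element has rank at most $u$. $A_q(v,d;k)$ is the maximum number of $k$-dimensional subspaces of $\mathbb{F}_q^v$ with pairwise subspace distance $\dim(U+W)-\dim(U\cap W)$ at least $d$. *)

theory Defs
  imports "HOL-Analysis.Cartesian_Space"
begin

text \<open>
  The field with \<open>q\<close> elements is a type \<open>'f\<close> of classes \<open>field\<close> and \<open>finite\<close>, where
  \<open>q = CARD('f)\<close>. An \<open>a \<times> b\<close> matrix (\<open>a\<close> rows, \<open>b\<close> columns) has type \<open>'f ^ 'b ^ 'a\<close> with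
  \<open>a = CARD('a)\<close> and \<open>b = CARD('b)\<close>; the ambient space of dimension \<open>v = CARD('v)\<close> is
  \<open>'f ^ 'v\<close>.
\<close>

definition bounded_rank_code :: "nat \<Rightarrow> nat \<Rightarrow> ('f::{field,finite} ^ 'b ^ 'a) set \<Rightarrow> bool" where
  "bounded_rank_code d u C \<longleftrightarrow>
     (\<forall>X\<in>C. \<forall>Y\<in>C. X \<noteq> Y \<longrightarrow> d \<le> rank (X - Y)) \<and> (\<forall>X\<in>C. rank X \<le> u)"

definition Lambda ::
    "'f::{field,finite} itself \<Rightarrow> 'a::finite itself \<Rightarrow> 'b::finite itself \<Rightarrow> nat \<Rightarrow> nat \<Rightarrow> nat" where
  "Lambda _ _ _ d u = Max {card C | C :: ('f ^ 'b ^ 'a) set. bounded_rank_code d u C}"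

text \<open>The subtraction does not truncate, since the intersection is contained in the sum.\<close>

definition subspace_dist :: "('f::field ^ 'v) set \<Rightarrow> ('f ^ 'v) set \<Rightarrow> nat" where
  "subspace_dist U W = vec.dim {x + y | x y. x \<in> U \<and> y \<in> W} - vec.dim (U \<inter> W)"

definition const_dim_code :: "nat \<Rightarrow> nat \<Rightarrow> ('f::{field,finite} ^ 'v) set set \<Rightarrow> bool" where
  "const_dim_code d k C \<longleftrightarrow>
     (\<forall>U\<in>C. vec.subspace U \<and> vec.dim U = k) \<and>
     (\<forall>U\<in>C. \<forall>W\<in>C. U \<noteq> W \<longrightarrow> d \<le> subspace_dist U W)"

definition A_code :: "'f::{field,finite} itself \<Rightarrow> 'v::finite itself \<Rightarrow> nat \<Rightarrow> nat \<Rightarrow> nat" where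
  "A_code _ _ d k = Max {card C | C :: ('f ^ 'v) set set. const_dim_code d k C}"

text \<open>Both maxima range over finite nonempty sets, so \<open>Max\<close> is a genuine maximum.\<close>

lemma Lambda_range_ok:
  "finite {card C | C :: ('f::{field,finite} ^ 'b::finite ^ 'a::finite) set. bounded_rank_code d u C}"
  "{card C | C :: ('f ^ 'b ^ 'a) set. bounded_rank_code d u C} \<noteq> {}"
proof -
  show "finite {card C | C :: ('f ^ 'b ^ 'a) set. bounded_rank_code d u C}"
    by simp
  have "bounded_rank_code d u ({} :: ('f ^ 'b ^ 'a) set)"
    by (simp add: bounded_rank_code_def)
  then show "{card C | C :: ('f ^ 'b ^ 'a) set. bounded_rank_code d u C} \<noteq> {}"
    by blast
qed

lemma A_code_range_ok:
  "finite {card C | C :: ('f::{field,finite} ^ 'v::finite) set set. const_dim_code d k C}"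
  "{card C | C :: ('f ^ 'v) set set. const_dim_code d k C} \<noteq> {}"
proof -
  show "finite {card C | C :: ('f ^ 'v) set set. const_dim_code d k C}"
    by simp
  have "const_dim_code d k ({} :: ('f ^ 'v) set set)"
    by (simp add: const_dim_code_def)
  then show "{card C | C :: ('f ^ 'v) set set. const_dim_code d k C} \<noteq> {}"
    by blast
qed

end

theory Submission imports Defs begin

text \<open>
  Any two subspaces of equal dimension are the column space and the row space of some matrix, so
  two subspace codes of the same size and dimension are the column spaces and the row spaces of a
  set of matrices. For any matrices \<open>A\<close> and \<open>B\<close>, multiplication by \<open>A\<close> maps the null space of
  \<open>A - B\<close> into the intersection of the column spaces, and its kernel there is the intersection of
  the null spaces, that is, the annihilator of the sum of the row spaces. Counting dimensions,
  \<open>rk (A - B) \<ge> dim (row A + row B) - dim (col A \<inter> col B)\<close>, and the right-hand side is half the sum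
  of the subspace distances of the row spaces and of the column spaces.
\<close>

lemma (in finite_dimensional_vector_space_pair_1) dim_image_plus_dim_kernel:
  assumes linear_f: "Vector_Spaces.linear s1 s2 f" and subspace_V: "vs1.subspace V"
  shows "vs2.dim (f ` V) + vs1.dim {x \<in> V. f x = 0} = vs1.dim V"
proof -
  interpret f: Vector_Spaces.linear s1 s2 f
    by (rule linear_f)
  obtain g where range_g: "range g \<subseteq> V" and linear_g: "Vector_Spaces.linear s2 s1 g"
    and f_g: "\<forall>y\<in>f ` V. f (g y) = y"
    using linear_exists_right_inverse_on[OF linear_f subspace_V] by blast
  interpret g: Vector_Spaces.linear s2 s1 g
    by (rule linear_g)
  define K where "K = {x \<in> V. f x = 0}"
  define W where "W = g ` f ` V"
  have subspace_K: "vs1.subspace K"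
    using vs1.subspace_inter[OF subspace_V f.subspace_kernel] by (simp add: K_def Collect_conj_eq)
  have subspace_W: "vs1.subspace W"
    unfolding W_def by (intro g.subspace_image f.subspace_image subspace_V)
  have f_W: "f ` W = f ` V"
    using f_g by (simp add: W_def image_image)
  have inj_on_W: "inj_on f W"
    using f_g by (auto simp: W_def inj_on_def)
  have sum_eq: "{x + y | x y. x \<in> K \<and> y \<in> W} = V"
  proof (intro equalityI subsetI)
    fix x assume "x \<in> V"
    then have "x - g (f x) \<in> K" "g (f x) \<in> W"
      using range_g f_g subspace_V
      by (auto simp: K_def W_def f.diff intro!: vs1.subspace_diff)
    moreover have "x = x - g (f x) + g (f x)"
      by simp
    ultimately show "x \<in> {x + y | x y. x \<in> K \<and> y \<in> W}"
      by blast
  qed (use range_g subspace_V in \<open>auto simp: K_def W_def intro!: vs1.subspace_add\<close>)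
  have Int_eq: "K \<inter> W = {0}"
    using vs1.subspace_0[OF subspace_K] vs1.subspace_0[OF subspace_W] inj_on_W
    by (auto simp: K_def f.inj_on_iff_eq_0[OF subspace_W])
  have "vs2.dim (f ` V) = vs1.dim W"
    using dim_image_eq[OF linear_f, of W] inj_on_W f_W subspace_W
    by (simp flip: vs1.span_eq_iff)
  then show ?thesis
    using vs1.dim_sums_Int[OF subspace_K subspace_W] by (simp add: sum_eq Int_eq flip: K_def)
qed

lemma obtain_invertible_matrix_containing_rows:
  fixes B :: "('f::field ^ 'n) set"
  assumes "vec.independent B"
  obtains M :: "'f ^ 'n ^ 'n" and I where "invertible M" "bij_betw (\<lambda>i. row i M) I B"
proof -
  obtain E where "B \<subseteq> E" and indep_E: "vec.independent E" and span_E: "UNIV \<subseteq> vec.span E"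
    by (rule vec.maximal_independent_subset_extend[OF subset_UNIV assms])
  have "card E = CARD('n)"
    using vec.basis_card_eq_dim[OF subset_UNIV span_E indep_E] by (simp add: card_cart_basis)
  then obtain r :: "'n \<Rightarrow> 'f ^ 'n" where r: "bij_betw r UNIV E"
    using finite_same_card_bij[of "UNIV :: 'n set" E] vec.finiteI_independent[OF indep_E] by auto
  define M :: "'f ^ 'n ^ 'n" where "M = (\<chi> i. r i)"
  have row_M: "row i M = r i" for i
    by (simp add: M_def row_def)
  have "rows M = E"
    using r by (auto simp: rows_def row_M bij_betw_def)
  then have "invertible M"
    using span_E by (simp add: invertible_left_inverse matrix_left_invertible_span_rows_gen
        top.extremum_unique)
  moreover have "bij_betw (\<lambda>i. row i M) (r -` B) B"
    unfolding row_M using \<open>B \<subseteq> E\<close> r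
    by (auto simp: bij_betw_def inj_on_def image_vimage_eq)
  ultimately show ?thesis
    by (rule that)
qed

definition annihilator :: "('f::semiring_1 ^ 'n) set \<Rightarrow> ('f ^ 'n) set" where
  "annihilator S = {x. \<forall>s\<in>S. scalar_product s x = 0}"

definition row_space :: "'f::field ^ 'n ^ 'm \<Rightarrow> ('f ^ 'n) set" where
  "row_space A = vec.span (rows A)"

definition col_space :: "'f::field ^ 'n ^ 'm \<Rightarrow> ('f ^ 'm) set" where
  "col_space A = vec.span (columns A)"

definition null_space :: "'f::semiring_1 ^ 'n ^ 'm \<Rightarrow> ('f ^ 'n) set" where
  "null_space A = {x. A *v x = 0}"

lemma matrix_vector_mult_component: "(A *v x) $ i = scalar_product (row i A) x"
  by (simp add: matrix_vector_mult_def scalar_product_def row_def)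

lemma null_space_eq_annihilator_rows: "null_space A = annihilator (rows A)"
  by (auto simp: null_space_def annihilator_def rows_def full_SetCompr_eq
      matrix_vector_mult_component vec_eq_iff[of _ 0])

lemma annihilator_Un: "annihilator (S \<union> T) = annihilator S \<inter> annihilator T"
  by (auto simp: annihilator_def)

lemma annihilator_span: "annihilator (vec.span S) = annihilator (S :: ('f::field ^ 'n) set)"
proof
  show "annihilator S \<subseteq> annihilator (vec.span S)"
  proof
    fix x assume x: "x \<in> annihilator S"
    have "vec.subspace {s. scalar_product s x = 0}"
      by (simp add: vec.subspace_def scalar_product_def distrib_right sum.distrib mult.assoc
          flip: sum_distrib_left)
    then have "vec.span S \<subseteq> {s. scalar_product s x = 0}"
      using x by (intro vec.span_minimal) (auto simp: annihilator_def)
    then show "x \<in> annihilator (vec.span S)"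
      by (auto simp: annihilator_def)
  qed
qed (auto simp: annihilator_def vec.span_base)

lemma dim_annihilator:
  fixes S :: "('f::field ^ 'n) set"
  shows "vec.dim (annihilator S) + vec.dim S = CARD('n)"
proof -
  obtain B where "B \<subseteq> S" and indep_B: "vec.independent B" and "S \<subseteq> vec.span B"
    and card_B: "card B = vec.dim S"
    by (rule vec.basis_exists)
  obtain M :: "'f ^ 'n ^ 'n" and I where "invertible M" and bij_I: "bij_betw (\<lambda>i. row i M) I B"
    by (rule obtain_invertible_matrix_containing_rows[OF indep_B])
  have inj_M: "inj ((*v) M)" and surj_M: "surj ((*v) M)"
    using \<open>invertible M\<close> matrix_left_invertible_injective[of M]
      matrix_right_invertible_surjective[of M] by (auto simp: invertible_def)
  have "vec.span S = vec.span B"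
    using \<open>B \<subseteq> S\<close> \<open>S \<subseteq> vec.span B\<close> by (auto simp: vec.span_eq intro: vec.span_base)
  then have "annihilator S = annihilator B"
    using annihilator_span by metis
  also have "\<dots> = (*v) M -` {y. \<forall>i\<in>I. y $ i = 0}"
    using bij_I by (auto simp: annihilator_def matrix_vector_mult_component bij_betw_def)
  finally have "(*v) M ` annihilator S = {y. \<forall>i\<in>I. y $ i = 0}"
    by (simp only: surj_image_vimage_eq[OF surj_M])
  then have "vec.dim ((*v) M ` annihilator S) = card (- I)"
    using dim_substandard_cart[of "- I", where 'a='f] by (simp add: Ball_def)
  moreover have "vec.dim ((*v) M ` annihilator S) = vec.dim (annihilator S)"
    using inj_M by (intro vec.dim_image_eq) (auto intro: inj_on_subset)
  moreover have "card I = vec.dim S"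
    using bij_betw_same_card[OF bij_I] card_B by simp
  moreover have "card (- I) + card I = CARD('n)"
    using card_mono[OF finite subset_UNIV, of I]
    by (simp add: Compl_eq_Diff_UNIV card_Diff_subset)
  ultimately show ?thesis
    by simp
qed

lemma dim_row_space: "vec.dim (row_space A) = rank A"
  by (simp add: row_space_def row_rank_def_gen)

lemma rank_plus_dim_null_space:
  fixes A :: "'f::field ^ 'n ^ 'm"
  shows "rank A + vec.dim (null_space A) = CARD('n)"
  using dim_annihilator[of "rows A"]
  by (simp add: null_space_eq_annihilator_rows row_rank_def_gen)

lemma range_matrix_vector_mult_eq_col_space: "range ((*v) A) = col_space A"
proof
  show "range ((*v) A) \<subseteq> col_space A"
    using matrix_vector_mult_in_columnspace_gen by (auto simp: col_space_def)
  have "column i A = A *v axis i 1" for i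
    by (simp add: vec_eq_iff column_def matrix_vector_mult_def axis_def if_distrib cong: if_cong)
  then have "columns A \<subseteq> range ((*v) A)"
    by (auto simp: columns_def)
  then show "col_space A \<subseteq> range ((*v) A)"
    unfolding col_space_def by (intro vec.span_minimal vec.subspace_image) auto
qed

lemma dim_col_space:
  fixes A :: "'f::field ^ 'n ^ 'm"
  shows "vec.dim (col_space A) = rank A"
  using vec.dim_image_plus_dim_kernel[of "(*v) A" UNIV] rank_plus_dim_null_space[of A]
  by (simp add: null_space_def card_cart_basis flip: range_matrix_vector_mult_eq_col_space)

lemma subspace_row_space: "vec.subspace (row_space A)"
  by (simp add: row_space_def)

lemma subspace_col_space: "vec.subspace (col_space A)"
  by (simp add: col_space_def)

lemma dim_sum_row_spaces_plus_dim_Int_null_spaces: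
  fixes A :: "'f::field ^ 'n ^ 'm" and B :: "'f ^ 'n ^ 'k"
  shows "vec.dim {x + y | x y. x \<in> row_space A \<and> y \<in> row_space B}
    + vec.dim (null_space A \<inter> null_space B) = CARD('n)"
  using dim_annihilator[of "rows A \<union> rows B"]
  by (simp add: row_space_def null_space_eq_annihilator_rows annihilator_Un flip: vec.span_Un)

lemma dim_null_space_diff_le:
  fixes A B :: "'f::field ^ 'n ^ 'm"
  shows "vec.dim (null_space (A - B))
    \<le> vec.dim (col_space A \<inter> col_space B) + vec.dim (null_space A \<inter> null_space B)"
proof -
  have "vec.dim (null_space (A - B))
      = vec.dim ((*v) A ` null_space (A - B)) + vec.dim {x \<in> null_space (A - B). A *v x = 0}"
    by (rule vec.dim_image_plus_dim_kernel[symmetric])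
      (auto simp: null_space_def intro: vec.subspace_kernel)
  also have "(*v) A ` null_space (A - B) \<subseteq> col_space A \<inter> col_space B"
    by (auto simp: null_space_def matrix_vector_mult_diff_rdistrib
        simp flip: range_matrix_vector_mult_eq_col_space) (metis rangeI)
  also have "{x \<in> null_space (A - B). A *v x = 0} = null_space A \<inter> null_space B"
    by (auto simp: null_space_def matrix_vector_mult_diff_rdistrib)
  finally show ?thesis
    by (simp add: vec.dim_subset)
qed

lemma subspace_dist_plus_dim_Int:
  assumes "vec.subspace U" "vec.subspace W"
  shows "subspace_dist U W + 2 * vec.dim (U \<inter> W) = vec.dim U + vec.dim W"
  using vec.dim_sums_Int[OF assms] vec.dim_subset[of "U \<inter> W" U] vec.dim_subset[of "U \<inter> W" W]
  unfolding subspace_dist_def by simp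

lemma subspace_dist_plus_dim_plus_dim:
  assumes "vec.subspace U" "vec.subspace W"
  shows "subspace_dist U W + vec.dim U + vec.dim W = 2 * vec.dim {x + y | x y. x \<in> U \<and> y \<in> W}"
  using vec.dim_sums_Int[OF assms] subspace_dist_plus_dim_Int[OF assms] by linarith

lemma subspace_dist_col_spaces_plus_row_spaces_le:
  fixes A B :: "'f::field ^ 'n ^ 'm"
  shows "subspace_dist (col_space A) (col_space B) + subspace_dist (row_space A) (row_space B)
    \<le> 2 * rank (A - B)"
proof -
  let ?row_sum = "{x + y | x y. x \<in> row_space A \<and> y \<in> row_space B}"
  have "vec.dim ?row_sum \<le> rank (A - B) + vec.dim (col_space A \<inter> col_space B)"
    using dim_null_space_diff_le[of A B] rank_plus_dim_null_space[of "A - B"]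
      dim_sum_row_spaces_plus_dim_Int_null_spaces[of A B] by linarith
  moreover have "subspace_dist (col_space A) (col_space B)
      + 2 * vec.dim (col_space A \<inter> col_space B) = rank A + rank B"
    using subspace_dist_plus_dim_Int[OF subspace_col_space subspace_col_space, of A B]
    by (simp add: dim_col_space)
  moreover have "subspace_dist (row_space A) (row_space B) + rank A + rank B
      = 2 * vec.dim ?row_sum"
    using subspace_dist_plus_dim_plus_dim[OF subspace_row_space subspace_row_space, of A B]
    by (simp add: dim_row_space)
  ultimately show ?thesis
    by linarith
qed

definition sum_outer_products ::
    "('f::semiring_1 ^ 'm) set \<Rightarrow> ('f ^ 'm \<Rightarrow> 'f ^ 'n) \<Rightarrow> 'f ^ 'n ^ 'm" where
  "sum_outer_products S g = (\<chi> i j. \<Sum>s\<in>S. s $ i * g s $ j)"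

lemma row_space_sum_outer_products_subset:
  "row_space (sum_outer_products S g) \<subseteq> vec.span (g ` S)"
proof -
  have "row i (sum_outer_products S g) = (\<Sum>s\<in>S. s $ i *s g s)" for i
    by (simp add: sum_outer_products_def row_def vec_eq_iff)
  then show ?thesis
    unfolding row_space_def
    by (intro vec.span_minimal vec.subspace_span)
      (auto simp: rows_def intro: vec.span_sum vec.span_scale vec.span_base)
qed

lemma col_space_sum_outer_products_subset:
  "col_space (sum_outer_products S g) \<subseteq> vec.span S"
proof -
  have "column j (sum_outer_products S g) = (\<Sum>s\<in>S. g s $ j *s s)" for j
    by (simp add: sum_outer_products_def column_def vec_eq_iff mult.commute)
  then show ?thesis
    unfolding col_space_def
    by (intro vec.span_minimal vec.subspace_span)
      (auto simp: columns_def intro: vec.span_sum vec.span_scale vec.span_base)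
qed

lemma sum_outer_products_mult_vector:
  fixes g :: "'f::comm_semiring_1 ^ 'm \<Rightarrow> 'f ^ 'n"
  shows "sum_outer_products S g *v x = (\<Sum>s\<in>S. scalar_product (g s) x *s s)"
proof -
  have "(sum_outer_products S g *v x) $ i = (\<Sum>j\<in>UNIV. \<Sum>s\<in>S. g s $ j * x $ j * s $ i)" for i
    by (simp add: sum_outer_products_def matrix_vector_mult_def sum_distrib_left sum_distrib_right
        mult_ac)
  also have "\<dots> i = (\<Sum>s\<in>S. \<Sum>j\<in>UNIV. g s $ j * x $ j * s $ i)" for i
    by (rule sum.swap)
  finally show ?thesis
    by (simp add: vec_eq_iff scalar_product_def sum_distrib_right)
qed

lemma null_space_sum_outer_products:
  assumes "vec.independent S"
  shows "null_space (sum_outer_products S g) = annihilator (g ` S)"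
proof -
  have "(\<Sum>s\<in>S. k s *s s) = 0 \<longleftrightarrow> (\<forall>s\<in>S. k s = 0)" for k
    using vec.independentD[OF assms vec.finiteI_independent[OF assms] subset_refl] by auto
  then show ?thesis
    by (auto simp: null_space_def annihilator_def sum_outer_products_mult_vector)
qed

lemma exists_matrix_col_space_row_space:
  fixes U :: "('f::field ^ 'm) set" and W :: "('f ^ 'n) set"
  assumes subspace_U: "vec.subspace U" and subspace_W: "vec.subspace W"
    and dim_eq: "vec.dim U = vec.dim W"
  shows "\<exists>A :: 'f ^ 'n ^ 'm. col_space A = U \<and> row_space A = W"
proof -
  obtain S where indep_S: "vec.independent S" and span_S: "vec.span S = U"
    and card_S: "card S = vec.dim U"
    using vec.basis_exists vec.span_subspace subspace_U by metis
  obtain T where indep_T: "vec.independent T" and span_T: "vec.span T = W"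
    and card_T: "card T = vec.dim W"
    using vec.basis_exists vec.span_subspace subspace_W by metis
  obtain g where "bij_betw g S T"
    using finite_same_card_bij[of S T] indep_S indep_T card_S card_T dim_eq
      vec.finiteI_independent by metis
  then have g_S: "g ` S = T"
    by (rule bij_betw_imp_surj_on)
  let ?A = "sum_outer_products S g"
  have "rank ?A = vec.dim T"
    using rank_plus_dim_null_space[of ?A] dim_annihilator[of T]
    by (simp add: null_space_sum_outer_products[OF indep_S] g_S)
  then have rank_A: "rank ?A = vec.dim W"
    using span_T by auto
  have "col_space ?A = U"
    using col_space_sum_outer_products_subset[of S g] span_S rank_A dim_eq
    by (intro vec.subspace_dim_equal subspace_col_space subspace_U) (simp_all add: dim_col_space)
  moreover have "row_space ?A = W"
    using row_space_sum_outer_products_subset[of S g] g_S span_T rank_A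
    by (intro vec.subspace_dim_equal subspace_row_space subspace_W) (simp_all add: dim_row_space)
  ultimately show ?thesis
    by blast
qed

lemma obtain_matrices_bij_betw_col_space_row_space:
  fixes C :: "('f::field ^ 'm) set set" and D :: "('f ^ 'n) set set"
  assumes bij_p: "bij_betw p C D"
    and "\<And>U. U \<in> C \<Longrightarrow> vec.subspace U" and "\<And>W. W \<in> D \<Longrightarrow> vec.subspace W"
    and "\<And>U. U \<in> C \<Longrightarrow> vec.dim (p U) = vec.dim U"
  obtains M :: "('f ^ 'n ^ 'm) set" where "bij_betw col_space M C" "bij_betw row_space M D"
proof -
  have "\<forall>U\<in>C. \<exists>A :: 'f ^ 'n ^ 'm. col_space A = U \<and> row_space A = p U"
    using assms by (intro ballI exists_matrix_col_space_row_space) (auto simp: bij_betw_def)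
  then obtain A :: "('f ^ 'm) set \<Rightarrow> 'f ^ 'n ^ 'm"
    where A: "\<forall>U\<in>C. col_space (A U) = U \<and> row_space (A U) = p U"
    unfolding bchoice_iff by blast
  have col: "bij_betw col_space (A ` C) C"
    using A by (auto intro!: bij_betw_byWitness[where f' = A])
  have "bij_betw row_space (A ` C) D \<longleftrightarrow> bij_betw (p \<circ> col_space) (A ` C) D"
    using A by (intro bij_betw_cong) auto
  then have "bij_betw row_space (A ` C) D"
    using bij_betw_trans[OF col bij_p] by simp
  with col show ?thesis
    by (rule that)
qed

lemma bounded_rank_code_if_const_dim_codes:
  assumes col: "const_dim_code d\<^sub>1 u (col_space ` M)" "inj_on col_space M"
    and row: "const_dim_code d\<^sub>2 u (row_space ` M)" "inj_on row_space M"
    and dist_le: "2 * d \<le> d\<^sub>1 + d\<^sub>2"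
  shows "bounded_rank_code d u M"
  unfolding bounded_rank_code_def
proof (intro conjI ballI impI)
  fix X Y assume "X \<in> M" "Y \<in> M" "X \<noteq> Y"
  then have "d\<^sub>1 \<le> subspace_dist (col_space X) (col_space Y)"
    and "d\<^sub>2 \<le> subspace_dist (row_space X) (row_space Y)"
    using col row by (auto simp: const_dim_code_def inj_on_eq_iff)
  then show "d \<le> rank (X - Y)"
    using dist_le subspace_dist_col_spaces_plus_row_spaces_le[of X Y] by linarith
next
  fix X assume "X \<in> M"
  then show "rank X \<le> u"
    using row(1) by (auto simp: const_dim_code_def simp flip: dim_row_space)
qed

lemma const_dim_code_subset: "const_dim_code d k C \<Longrightarrow> D \<subseteq> C \<Longrightarrow> const_dim_code d k D"
  unfolding const_dim_code_def by blast

lemma obtain_const_dim_code_card: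
  assumes "m \<le> A_code TYPE('f::{field,finite}) TYPE('v::finite) d k"
  obtains C :: "('f::{field,finite} ^ 'v::finite) set set"
  where "const_dim_code d k C" "card C = m"
proof -
  have "A_code TYPE('f) TYPE('v) d k \<in> {card C | C :: ('f ^ 'v) set set. const_dim_code d k C}"
    unfolding A_code_def by (rule Max_in[OF A_code_range_ok])
  then obtain C :: "('f ^ 'v) set set" where C: "const_dim_code d k C" "m \<le> card C"
    using assms by auto
  obtain C' where "C' \<subseteq> C" "card C' = m"
    using obtain_subset_with_card_n[OF C(2)] by metis
  with const_dim_code_subset[OF C(1)] show ?thesis
    by (intro that)
qed

lemma card_le_Lambda:
  fixes M :: "('f::{field,finite} ^ 'b::finite ^ 'a::finite) set"
  assumes "bounded_rank_code d u M"
  shows "card M \<le> Lambda TYPE('f) TYPE('a) TYPE('b) d u"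
  unfolding Lambda_def using assms by (intro Max_ge Lambda_range_ok) auto

theorem theorem15:
  fixes d d\<^sub>1 d\<^sub>2 u :: nat
  assumes "d > 0" and "d\<^sub>1 > 0" and "d\<^sub>2 > 0" and "u > 0"
    and "2 * d \<le> d\<^sub>1 + d\<^sub>2"
  shows "Lambda TYPE('f::{field,finite}) TYPE('a::finite) TYPE('b::finite) d u
    \<ge> min (A_code TYPE('f) TYPE('a) d\<^sub>1 u) (A_code TYPE('f) TYPE('b) d\<^sub>2 u)"
    (is "_ \<ge> ?m")
proof -
  obtain C :: "('f ^ 'a) set set" where C: "const_dim_code d\<^sub>1 u C" and card_C: "card C = ?m"
    by (rule obtain_const_dim_code_card[OF min.cobounded1])
  obtain D :: "('f ^ 'b) set set" where D: "const_dim_code d\<^sub>2 u D" and card_D: "card D = ?m"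
    by (rule obtain_const_dim_code_card[OF min.cobounded2])
  obtain p where bij_p: "bij_betw p C D"
    using finite_same_card_bij[of C D] card_C card_D by auto
  obtain M :: "('f ^ 'b ^ 'a) set"
    where col: "bij_betw col_space M C" and row: "bij_betw row_space M D"
    by (rule obtain_matrices_bij_betw_col_space_row_space[OF bij_p])
      (use C D bij_p in \<open>auto simp: const_dim_code_def bij_betw_def\<close>)
  have "bounded_rank_code d u M"
    using C D col row \<open>2 * d \<le> d\<^sub>1 + d\<^sub>2\<close>
    by (intro bounded_rank_code_if_const_dim_codes) (auto simp: bij_betw_def)
  then have "card M \<le> Lambda TYPE('f) TYPE('a) TYPE('b) d u"
    by (rule card_le_Lambda)
  then show ?thesis
    using bij_betw_same_card[OF col] card_C by simp
qed

end
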